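(* Let $\lambda>-1/2$, $\lambda\neq1/2$, $n\ge1$. For $z>0$ let $(P_m(x,z))_{m\ge0}$ be the monic polynomials orthogonal with respect to the weight $(1-x^2)^{\lambda-1/2}e^{-zx^2}$ on $(-1,1)$, with $xP_m=P_{m+1}+\gamma_mP_{m-1}$, and let $x_{n,1}(z)<\dots<x_{n,n}(z)$ be the zeros of $P_n(x,z)$. Then, for $1\le k\le n$, they satisfy the differential equation $$\partial_zx_{n,k}(z)=-\frac{x_{n,k}(z)}{2z}\,\frac{1-x_{n,k}^2(z)}{\beta_n^2-x_{n,k}^2(z)},$$ where $\beta_n^2=\frac{n+\lambda}{z}+1-(\gamma_n+\gamma_{n+1})$.
   Context: The monic orthogonal polynomials satisfy $\deg P_m=m$ and $\int_{-1}^1P_mP_k(1-x^2)^{\lambda-1/2}e^{-zx^2}dx=0$ for $m\ne k$; since the weight is even, the recurrence has the stated form for $m\ge0$ with $P_{-1}=0$, $P_0=1$, and $\gamma_m=\gamma_m(z)$. The zeros of $P_n(\cdot,z)$ are real, simple and lie in $(-1,1)$. The parameter $\lambda$ is fixed. *)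

theory Defs
  imports "HOL-Analysis.Analysis" "HOL-Computational_Algebra.Polynomial"
begin

definition weight :: "real \<Rightarrow> real \<Rightarrow> real \<Rightarrow> real" where
  "weight lam z x = (1 - x\<^sup>2) powr (lam - 1/2) * exp (- z * x\<^sup>2)"

(* For lam > -1/2 the integrands below are Lebesgue integrable, so the convention that
   the integral of a non-integrable function is 0 plays no role. *)
definition monic_orthogonal :: "real \<Rightarrow> real \<Rightarrow> (nat \<Rightarrow> real poly) \<Rightarrow> bool" where
  "monic_orthogonal lam z p \<longleftrightarrow>
     (\<forall>m. degree (p m) = m \<and> lead_coeff (p m) = 1) \<and>
     (\<forall>m k. m \<noteq> k \<longrightarrow>
        (LBINT x:{-1<..<1}. poly (p m) x * poly (p k) x * weight lam z x) = 0)"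

(* x p_m = p_(m+1) + g_m p_(m-1) for all m >= 0, with p_(-1) = 0; thus g 0 is irrelevant. *)
definition has_recurrence :: "(nat \<Rightarrow> real poly) \<Rightarrow> (nat \<Rightarrow> real) \<Rightarrow> bool" where
  "has_recurrence p g \<longleftrightarrow>
     (\<forall>m. [:0, 1:] * p m = p (Suc m) + smult (g m) (if m = 0 then 0 else p (m - 1)))"

(* y 1 < ... < y n are exactly the real zeros of q; for degree q = n these are all of its zeros. *)
definition zeros_in_order :: "nat \<Rightarrow> real poly \<Rightarrow> (nat \<Rightarrow> real) \<Rightarrow> bool" where
  "zeros_in_order n q y \<longleftrightarrow>
     strict_mono_on {1..n} y \<and> {t. poly q t = 0} = y ` {1..n}"

(* The quantity written beta_n^2; g is the recurrence coefficient sequence at the given z. *)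
definition beta_sq :: "real \<Rightarrow> nat \<Rightarrow> real \<Rightarrow> (nat \<Rightarrow> real) \<Rightarrow> real" where
  "beta_sq lam n z g = (real n + lam) / z + 1 - (g n + g (Suc n))"

end

theory Submission
  imports Defs
begin

text \<open>Write \<open>L f\<close> for the integral of \<open>f w\<close>. Integration by parts gives the Pearson identity
  \<open>L ((1 - x\<^sup>2) f') = L (((2 lam + 1) x + 2 z x (1 - x\<^sup>2)) f)\<close>. Testing against polynomials of
  degree below \<open>n\<close> and replacing \<open>\<gamma>\<^sub>n P\<^sub>n\<^sub>-\<^sub>1\<close> by \<open>x P\<^sub>n - P\<^sub>n\<^sub>+\<^sub>1\<close>, one obtains two identities: from Pearson,
  \<open>(1 - x\<^sup>2) P\<^sub>n' + (n - 2 z \<gamma>\<^sub>n) x P\<^sub>n = 2 z \<gamma>\<^sub>n (\<beta>\<^sub>n\<^sup>2 - x\<^sup>2) P\<^sub>n\<^sub>-\<^sub>1\<close>, and from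
  differentiating the orthogonality relations in \<open>z\<close> (which multiplies the weight by \<open>- x\<^sup>2\<close>),
  \<open>\<partial>\<^sub>z P\<^sub>n = \<gamma>\<^sub>n (x P\<^sub>n\<^sub>-\<^sub>1 - P\<^sub>n)\<close>. At a zero of \<open>P\<^sub>n\<close> the quotient of the two is the claim.
  The left-hand side of the first identity does not vanish there, since the zeros are simple and
  \<open>P\<^sub>n\<close> has no zero at \<open>1\<close> or \<open>-1\<close>; hence neither does \<open>\<beta>\<^sub>n\<^sup>2 - x\<^sup>2\<close>.\<close>

subsection \<open>Orthogonal polynomials of a functional with a Pearson identity\<close>

text \<open>At a fixed \<open>z\<close> the algebra uses the integral only through these properties,
  so \<open>L\<close> stays an abstract functional on polynomials and the analysis is confined to
  its instantiation.\<close>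

locale pearson_functional =
  fixes L :: "real poly \<Rightarrow> real" and lam z :: real
    and p :: "nat \<Rightarrow> real poly" and g :: "nat \<Rightarrow> real"
  assumes L_add: "L (f + h) = L f + L h"
    and L_smult: "L (smult c f) = c * L f"
    and L_pos: "f \<noteq> 0 \<Longrightarrow> L (f * f) > 0"
    and pearson: "L ([:1, 0, -1:] * pderiv f) = L ([:0, 2 * lam + 1 + 2 * z, 0, - 2 * z:] * f)"
    and degree_p: "degree (p m) = m"
    and lead_p: "lead_coeff (p m) = 1"
    and orthogonal: "m \<noteq> k \<Longrightarrow> L (p m * p k) = 0"
    and recurrence: "has_recurrence p g"
begin

section \<open>Orthogonality, norms and leading coefficients\<close>

lemma L_zero [simp]: "L 0 = 0"
  using L_smult[of 0 0] by simp

lemma L_diff: "L (f - h) = L f - L h"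
  using L_add[of f "smult (-1) h"] L_smult[of "-1" h] by simp

lemma coeff_p_top [simp]: "coeff (p m) m = 1"
  using lead_p[of m] degree_p[of m] by simp

lemma p_nonzero: "p m \<noteq> 0"
  using coeff_p_top[of m] by (metis coeff_0 zero_neq_one)

lemma norm_pos: "L (p m * p m) > 0"
  by (rule L_pos[OF p_nonzero])

text \<open>Below degree \<open>m\<close>, leading terms are peeled off by multiples of
  \<open>p j\<close> with \<open>j < m\<close>, each orthogonal to \<open>p m\<close>; subtracting
  \<open>smult (coeff q m) (p m)\<close> reduces degree \<open>m\<close> to that case. As
  \<open>coeff q m\<close> is 0 when \<open>degree q < m\<close>, the formula contains plain
  orthogonality.\<close>

lemma L_p_mult:
  assumes "degree q \<le> m"
  shows "L (p m * q) = coeff q m * L (p m * p m)"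
proof -
  have low: "L (p m * q) = 0" if "degree q < m" for q
    using that
  proof (induction "degree q" arbitrary: q rule: less_induct)
    case less
    define r where "r = q - smult (lead_coeff q) (p (degree q))"
    have q: "q = smult (lead_coeff q) (p (degree q)) + r"
      by (simp add: r_def)
    have "degree r \<le> degree q"
      unfolding r_def by (rule degree_diff_le) (use degree_p in auto)
    moreover have "coeff r (degree q) = 0"
      by (simp add: r_def)
    ultimately have "r = 0 \<or> degree r < degree q"
      by (metis leading_coeff_0_iff le_neq_implies_less)
    then have "L (p m * r) = 0"
      using less by auto
    moreover have "L (p m * q) = lead_coeff q * L (p m * p (degree q)) + L (p m * r)"
      by (subst q) (simp only: distrib_left mult_smult_right L_add L_smult)
    ultimately show ?case
      using orthogonal[of m "degree q"] less.prems by simp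
  qed
  define r where "r = q - smult (coeff q m) (p m)"
  have q: "q = smult (coeff q m) (p m) + r"
    by (simp add: r_def)
  have "degree r \<le> m"
    unfolding r_def by (rule degree_diff_le) (use degree_p assms in auto)
  moreover have "coeff r m = 0"
    by (simp add: r_def)
  ultimately have "r = 0 \<or> degree r < m"
    by (metis leading_coeff_0_iff le_neq_implies_less)
  then have "L (p m * r) = 0"
    using low by auto
  moreover have "L (p m * q) = coeff q m * L (p m * p m) + L (p m * r)"
    by (subst q) (simp only: distrib_left mult_smult_right L_add L_smult)
  ultimately show ?thesis
    by simp
qed

lemma recurrence_Suc: "[:0, 1:] * p (Suc N) = p (Suc (Suc N)) + smult (g (Suc N)) (p N)"
  using spec[OF recurrence[unfolded has_recurrence_def], of "Suc N"] by simp

text \<open>The value of \<open>L\<close> at \<open>x p (Suc N) p N\<close> is computed twice, with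
  \<open>x\<close> attached to either factor. Later this writes \<open>g (Suc N)\<close> as a
  quotient of norms, which shows that it is differentiable in \<open>z\<close>.\<close>

lemma norm_Suc: "L (p (Suc N) * p (Suc N)) = g (Suc N) * L (p N * p N)"
proof -
  have "L (p (Suc N) * ([:0, 1:] * p N)) = coeff ([:0, 1:] * p N) (Suc N) * L (p (Suc N) * p (Suc N))"
    by (rule L_p_mult) (use degree_p[of N] in \<open>simp add: degree_pCons_le degree_mult_le\<close>)
  also have "\<dots> = L (p (Suc N) * p (Suc N))"
    by simp
  finally have "L (p (Suc N) * p (Suc N)) = L (p N * ([:0, 1:] * p (Suc N)))"
    by (simp add: mult.commute)
  also have "\<dots> = g (Suc N) * L (p N * p N)"
    unfolding recurrence_Suc distrib_left mult_smult_right L_add L_smult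
    using orthogonal[of N "Suc (Suc N)"] by simp
  finally show ?thesis .
qed

text \<open>The recurrence has no diagonal term, so multiplication by \<open>x\<close> passes the
  vanishing subleading coefficient on. This is the trace of parity used in the degree count of
  \<open>structure_relation\<close>.\<close>

lemma coeff_p_subleading: "coeff (p (Suc N)) N = 0"
proof (induction N)
  case 0
  have "[:0, 1:] * p 0 = p (Suc 0)"
    using spec[OF recurrence[unfolded has_recurrence_def], of 0] by simp
  then show ?case
    by (metis coeff_pCons_0 mult_pCons_left smult_0_left add_0)
next
  case (Suc N)
  have "coeff ([:0, 1:] * p (Suc N)) (Suc N) = 0"
    using Suc by simp
  then show ?case
    unfolding recurrence_Suc using degree_p[of N] by (simp add: coeff_eq_0)
qed

section \<open>The two polynomial identities at a fixed parameter\<close>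

lemma eq_0_if_orthogonal:
  assumes "degree d \<le> N" and "\<And>q. degree q \<le> N \<Longrightarrow> L (d * q) = 0"
  shows "d = 0"
  using assms(1) assms(2)[of d] L_pos[of d] by (metis less_irrefl)

lemma g_p:
  "smult (g (Suc N)) (p N) = [:0, 1:] * p (Suc N) - p (Suc (Suc N))"
  unfolding recurrence_Suc by simp

text \<open>With \<open>beta\<close> left free, the value depends on \<open>q\<close> only through
  its top coefficient, and for nonzero \<open>z\<close> the last factor vanishes exactly when
  \<open>beta\<close> is \<open>beta_sq\<close>. This is where that constant comes from.\<close>

lemma structure_relation_test:
  assumes "degree q \<le> N"
  shows "L (([:1, 0, -1:] * pderiv (p (Suc N))
      + smult (real (Suc N) - 2 * z * g (Suc N)) ([:0, 1:] * p (Suc N))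
      - smult (2 * z * g (Suc N)) ([:beta, 0, -1:] * p N)) * q)
    = coeff q N * L (p (Suc N) * p (Suc N)) *
      (2 * (real (Suc N) + lam) + 2 * z - 2 * z * (g (Suc N) + g (Suc (Suc N))) - 2 * z * beta)"
proof -
  define X :: "real poly" where "X = [:0, 1:]"
  define P Q R where "P = p (Suc N)" and "Q = p N" and "R = p (Suc (Suc N))"
  define \<gamma> where "\<gamma> = g (Suc N)"
  define H where "H = L (P * P)"
  define c where "c = coeff q N"
  have degX: "degree (X * f) \<le> Suc (degree f)" for f
    unfolding X_def by (simp add: degree_pCons_le)
  have cX: "coeff (X * f) (Suc i) = coeff f i" "coeff (X * f) 0 = 0" for f i
    unfolding X_def by simp_all
  \<comment> \<open>The operator \<open>x d/dx\<close> multiplies each coefficient by its index, so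
    it does not raise the degree.\<close>
  have cXd: "coeff (X * pderiv q) i = real i * coeff q i" for i
    by (cases i) (simp_all add: cX coeff_pderiv)
  have degXd: "degree (X * pderiv q) \<le> N"
    by (rule degree_le) (use assms in \<open>auto simp: cXd coeff_eq_0\<close>)
  have P1: "L (P * (X * q)) = c * H"
    using L_p_mult[of "X * q" "Suc N"] assms degX[of q] by (simp add: P_def H_def c_def cX)
  have P2: "L (P * pderiv q) = 0"
    using L_p_mult[of "pderiv q" "Suc N"] assms degree_pderiv[of q]
    by (simp add: P_def coeff_eq_0)
  have P3: "L (P * (X * (X * pderiv q))) = real N * c * H"
    using L_p_mult[of "X * (X * pderiv q)" "Suc N"] degXd degX[of "X * pderiv q"]
    by (simp add: P_def H_def c_def cX cXd)
  have Q1: "\<gamma> * L (Q * q) = c * H"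
    using L_p_mult[OF assms] norm_Suc[of N] by (simp add: P_def Q_def H_def c_def \<gamma>_def)
  have R1: "L (R * (X * (X * q))) = c * g (Suc (Suc N)) * H"
    using L_p_mult[of "X * (X * q)" "Suc (Suc N)"] assms degX[of q] degX[of "X * q"] norm_Suc[of "Suc N"]
    by (simp add: P_def R_def H_def c_def cX)
  have gQ: "smult \<gamma> Q = X * P - R"
    unfolding \<gamma>_def Q_def P_def R_def X_def by (rule g_p)
  \<comment> \<open>\<open>L_p_mult\<close> cannot evaluate this directly: \<open>x^2 q\<close> may
    have degree \<open>N + 2\<close>, above the index of \<open>Q\<close>. Trading \<gamma>
    \<open>Q\<close> for \<open>x P - R\<close> leaves the known \<open>R1\<close> and the moment of
    \<open>x^3 P q\<close>.\<close>
  have "smult \<gamma> (Q * (X * (X * q))) = P * (X * (X * (X * q))) - R * (X * (X * q))"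
    unfolding mult_smult_left[symmetric] gQ by (simp add: algebra_simps)
  then have Q2: "\<gamma> * L (Q * (X * (X * q))) = L (P * (X * (X * (X * q)))) - c * g (Suc (Suc N)) * H"
    by (metis L_smult L_diff R1)
  have c1: "[:1, 0, -1:] = 1 - X * X" and c2: "[:beta, 0, -1:] = smult beta 1 - X * X"
    and c3: "[:0, 2 * lam + 1 + 2 * z, 0, - 2 * z:]
      = smult (2 * lam + 1 + 2 * z) X - smult (2 * z) (X * (X * X))"
    unfolding X_def by (simp_all add: one_pCons)
  have e1: "[:1, 0, -1:] * pderiv (P * q)
      = [:1, 0, -1:] * pderiv P * q + P * pderiv q - P * (X * (X * pderiv q))"
    unfolding c1 pderiv_mult by (simp add: algebra_simps)
  have e2: "[:0, 2 * lam + 1 + 2 * z, 0, - 2 * z:] * (P * q)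
      = smult (2 * lam + 1 + 2 * z) (P * (X * q)) - smult (2 * z) (P * (X * (X * (X * q))))"
    unfolding c3 left_diff_distrib mult_smult_left by (simp add: mult_ac)
  \<comment> \<open>The moment of \<open>x^3 P q\<close> is never computed: it enters here with
    factor \<open>- 2 z\<close> and through \<open>Q2\<close> with \<open>2 z\<close>, and cancels
    in the final sum.\<close>
  have "L ([:1, 0, -1:] * pderiv P * q) + L (P * pderiv q) - L (P * (X * (X * pderiv q)))
      = (2 * lam + 1 + 2 * z) * L (P * (X * q)) - 2 * z * L (P * (X * (X * (X * q))))"
    using pearson[of "P * q"] unfolding e1 e2 L_add L_diff L_smult .
  then have S: "L ([:1, 0, -1:] * pderiv P * q)
      = (2 * lam + 1 + 2 * z + real N) * c * H - 2 * z * L (P * (X * (X * (X * q))))"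
    unfolding P1 P2 P3 by (simp add: algebra_simps)
  have "([:1, 0, -1:] * pderiv P + smult (real (Suc N) - 2 * z * \<gamma>) (X * P)
        - smult (2 * z * \<gamma>) ([:beta, 0, -1:] * Q)) * q
      = [:1, 0, -1:] * pderiv P * q + smult (real (Suc N) - 2 * z * \<gamma>) (P * (X * q))
        - smult (2 * z * beta * \<gamma>) (Q * q) + smult (2 * z * \<gamma>) (Q * (X * (X * q)))"
    unfolding c2 distrib_right left_diff_distrib mult_smult_left smult_diff_right
    by (simp add: mult_ac)
  then have "L (([:1, 0, -1:] * pderiv P + smult (real (Suc N) - 2 * z * \<gamma>) (X * P)
        - smult (2 * z * \<gamma>) ([:beta, 0, -1:] * Q)) * q)
      = L ([:1, 0, -1:] * pderiv P * q) + (real (Suc N) - 2 * z * \<gamma>) * L (P * (X * q))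
        - (2 * z * beta) * (\<gamma> * L (Q * q)) + 2 * z * (\<gamma> * L (Q * (X * (X * q))))"
    by (simp only: L_add L_diff L_smult mult.assoc)
  also have "\<dots> = c * H * (2 * (real (Suc N) + lam) + 2 * z
      - 2 * z * (\<gamma> + g (Suc (Suc N))) - 2 * z * beta)"
    unfolding S P1 Q1 Q2 by (simp add: algebra_simps)
  finally show ?thesis
    unfolding P_def Q_def \<gamma>_def X_def c_def H_def .
qed

lemma structure_relation:
  assumes "z \<noteq> 0"
  shows "[:1, 0, -1:] * pderiv (p (Suc N))
      + smult (real (Suc N) - 2 * z * g (Suc N)) ([:0, 1:] * p (Suc N))
    = smult (2 * z * g (Suc N)) ([:beta_sq lam (Suc N) z g, 0, -1:] * p N)"
proof -
  define D where "D = [:1, 0, -1:] * pderiv (p (Suc N))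
      + smult (real (Suc N) - 2 * z * g (Suc N)) ([:0, 1:] * p (Suc N))
      - smult (2 * z * g (Suc N)) ([:beta_sq lam (Suc N) z g, 0, -1:] * p N)"
  have zero: "coeff (p m) i = 0" if "i > m" for m i
    using that degree_p[of m] by (simp add: coeff_eq_0)
  \<comment> \<open>At \<open>N + 2\<close> the contributions of the three terms sum to zero because
    \<open>p N\<close> and \<open>p (Suc N)\<close> are monic; at \<open>N + 1\<close> only
    subleading coefficients occur, and these vanish.\<close>
  have "coeff D i = 0" if "i > N" for i
  proof -
    consider "i = Suc N" | "i = Suc (Suc N)" | j where "i = Suc (Suc j)" "j > N"
      using \<open>i > N\<close> by (metis Suc_lessI less_imp_Suc_add not_less_eq add_Suc_shift)
    then show ?thesis
    proof cases
      case 1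
      then show ?thesis
        unfolding D_def using coeff_p_subleading[of N] coeff_p_subleading[of "N - 1"]
        by (cases N) (simp_all add: coeff_pderiv zero coeff_pCons split: nat.split)
    next
      case 2
      then show ?thesis
        unfolding D_def by (simp add: coeff_pderiv zero algebra_simps)
    next
      case 3
      then show ?thesis
        unfolding D_def by (simp add: coeff_pderiv zero)
    qed
  qed
  then have "degree D \<le> N"
    by (intro degree_le) auto
  moreover have "L (D * q) = 0" if "degree q \<le> N" for q
    unfolding D_def structure_relation_test[OF that] beta_sq_def using assms
    by (simp add: field_simps)
  ultimately have "D = 0"
    by (rule eq_0_if_orthogonal)
  then show ?thesis
    by (simp add: D_def)
qed

text \<open>Here \<open>d\<close> stands for the derivative of \<open>p (Suc N)\<close> in
  \<open>z\<close>. In the difference of the two sides the terms of degree \<open>N + 1\<close>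
  cancel. Tested against \<open>q\<close>, the term in \<open>x p N\<close> becomes
  \<open>x^2 p (Suc N) q\<close> minus \<open>x p (Suc (Suc N)) q\<close>, and the latter integrates
  to zero.\<close>

lemma deformation_relation:
  assumes "degree d \<le> N"
    and "\<And>q. degree q \<le> N \<Longrightarrow> L (d * q) = L ([:0, 0, 1:] * p (Suc N) * q)"
  shows "d = smult (g (Suc N)) ([:0, 1:] * p N - p (Suc N))"
proof -
  define X :: "real poly" where "X = [:0, 1:]"
  define P Q R where "P = p (Suc N)" and "Q = p N" and "R = p (Suc (Suc N))"
  define \<gamma> where "\<gamma> = g (Suc N)"
  define r where "r = d - smult \<gamma> (X * Q - P)"
  have degX: "degree (X * f) \<le> Suc (degree f)" for f
    unfolding X_def by (simp add: degree_pCons_le)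
  have cX: "coeff (X * f) (Suc i) = coeff f i" for f i
    unfolding X_def by simp
  have "coeff r i = 0" if "i > N" for i
  proof -
    from that obtain j where "i = Suc j" "j \<ge> N"
      by (cases i) auto
    then show ?thesis
      using assms(1) degree_p[of N] degree_p[of "Suc N"]
      by (cases "j = N") (simp_all add: r_def P_def Q_def cX coeff_eq_0)
  qed
  then have "degree r \<le> N"
    by (intro degree_le) auto
  moreover have "L (r * q) = 0" if q: "degree q \<le> N" for q
  proof -
    have XX: "[:0, 0, 1:] = X * X"
      by (simp add: X_def)
    have "L (P * q) = 0"
      using L_p_mult[of q "Suc N"] q by (simp add: P_def coeff_eq_0)
    moreover have "L (R * (X * q)) = 0"
      using L_p_mult[of "X * q" "Suc (Suc N)"] q degX[of q] by (simp add: R_def coeff_eq_0)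
    moreover have gQ: "smult \<gamma> Q = X * P - R"
      unfolding \<gamma>_def Q_def P_def R_def X_def by (rule g_p)
    have "r * q = d * q - X * q * smult \<gamma> Q + smult \<gamma> (P * q)"
      unfolding r_def by (simp add: algebra_simps smult_diff_right)
    then have "r * q = d * q - (X * X * P * q - R * (X * q)) + smult \<gamma> (P * q)"
      unfolding gQ by (simp add: algebra_simps)
    ultimately show ?thesis
      using assms(2)[OF q] by (simp only: L_add L_diff L_smult XX P_def)
  qed
  ultimately have "r = 0"
    by (rule eq_0_if_orthogonal)
  then show ?thesis
    by (simp add: r_def \<gamma>_def X_def Q_def P_def)
qed

end

subsection \<open>The weighted integral\<close>

definition weighted_integral :: "real \<Rightarrow> real \<Rightarrow> real poly \<Rightarrow> real" where
  "weighted_integral lam z f = (LBINT x:{-1<..<1}. poly f x * weight lam z x)"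

section \<open>Integrability, positivity and integration by parts\<close>

lemma weight_measurable [measurable]: "weight lam z \<in> borel_measurable borel"
  unfolding weight_def[abs_def] by measurable

lemma poly_measurable [measurable]: "poly (f :: real poly) \<in> borel_measurable borel"
  by (intro borel_measurable_continuous_onI continuous_intros)

lemma weight_nonneg: "weight lam z x \<ge> 0"
  by (simp add: weight_def)

lemma square_less_1: "x \<in> {-1<..<1} \<Longrightarrow> x\<^sup>2 < (1::real)"
  by (auto simp: abs_square_less_1)

lemma weight_pos: "x \<in> {-1<..<1} \<Longrightarrow> weight lam z x > 0"
  using square_less_1[of x] by (simp add: weight_def)

text \<open>The substitution \<open>x = 2 t - 1\<close> turns \<open>1 - x^2\<close> into
  \<open>4 t (1 - t)\<close>, which gives the Beta integral with both arguments
  \<open>a + 1\<close>.\<close>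

lemma integrable_jacobi_weight:
  assumes "a > -1"
  shows "set_integrable lborel {-1<..<1} (\<lambda>x::real. (1 - x\<^sup>2) powr a)"
proof -
  define f where "f t = t powr a * (1 - t) powr a" for t :: real
  have "f integrable_on {0..1}"
    using has_integral_Beta_real[of "a + 1" "a + 1"] assms
    by (auto simp: f_def[abs_def] integrable_on_def)
  then have "f integrable_on {0<..<1}"
    by (simp add: integrable_on_Icc_iff_Ioo)
  then have "f absolutely_integrable_on {0<..<1}"
    by (intro nonnegative_absolutely_integrable_1) (auto simp: f_def)
  then have "set_integrable lborel {0<..<1} f"
    by (simp add: set_integrable_def f_def[abs_def] integrable_completion)
  then have "integrable lborel (\<lambda>x. indicator {0<..<1} (1/2 + 1/2 * x) *\<^sub>R f (1/2 + 1/2 * x))"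
    unfolding set_integrable_def by (intro lborel_integrable_real_affine) auto
  then have "integrable lborel (\<lambda>x. 4 powr a * (indicator {0<..<1} (1/2 + 1/2 * x) *\<^sub>R f (1/2 + 1/2 * x)))"
    by (rule integrable_mult_right)
  moreover have eq: "4 powr a * (indicator {0<..<1} (1/2 + 1/2 * x) *\<^sub>R f (1/2 + 1/2 * x))
      = indicator {-1<..<1} x *\<^sub>R (1 - x\<^sup>2) powr a" for x :: real
  proof (cases "x \<in> {-1<..<1}")
    case True
    have "1 - x\<^sup>2 = 4 * ((1/2 + 1/2 * x) * (1 - (1/2 + 1/2 * x)))"
      by (simp add: power2_eq_square field_simps)
    then have "(1 - x\<^sup>2) powr a = 4 powr a * f (1/2 + 1/2 * x)"
      unfolding f_def using True by (simp only: powr_mult)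
    then show ?thesis
      using True by (simp add: indicator_def)
  next
    case False
    then show ?thesis
      by (auto simp: indicator_def)
  qed
  ultimately show ?thesis
    unfolding set_integrable_def eq by simp
qed

lemma poly_bounded_Ioo: "\<exists>B>0. \<forall>x\<in>{-1<..<1}. \<bar>poly f x\<bar> \<le> (B::real)"
proof -
  have "compact (poly f ` {-1..1})"
    by (intro compact_continuous_image continuous_intros) auto
  then obtain B where "B > 0" "\<And>x. x \<in> {-1..1} \<Longrightarrow> \<bar>poly f x\<bar> \<le> B"
    by (force dest!: compact_imp_bounded simp: bounded_pos)
  then show ?thesis
    by (intro exI[of _ B]) auto
qed

lemma integrable_poly_weight:
  assumes "lam > -1/2" "z \<ge> 0"
  shows "set_integrable lborel {-1<..<1} (\<lambda>x. poly f x * weight lam z x)"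
proof -
  obtain B where B: "B > 0" "\<And>x. x \<in> {-1<..<1} \<Longrightarrow> \<bar>poly f x\<bar> \<le> B"
    using poly_bounded_Ioo[of f] by auto
  have "set_integrable lborel {-1<..<1} (\<lambda>x. B * (1 - x\<^sup>2) powr (lam - 1/2))"
    using integrable_jacobi_weight[of "lam - 1/2"] assms by simp
  then show ?thesis
  proof (rule set_integrable_bound)
    show "set_borel_measurable lborel {-1<..<1} (\<lambda>x. poly f x * weight lam z x)"
      unfolding set_borel_measurable_def by measurable
    have "norm (poly f x * weight lam z x) \<le> norm (B * (1 - x\<^sup>2) powr (lam - 1/2))"
      if "x \<in> {-1<..<1}" for x
    proof -
      have "(1 - x\<^sup>2) powr (lam - 1/2) * exp (- z * x\<^sup>2) \<le> (1 - x\<^sup>2) powr (lam - 1/2) * 1"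
        using assms by (intro mult_left_mono) auto
      then show ?thesis
        using B(2)[OF that] B(1) by (auto simp: weight_def abs_mult intro!: mult_mono)
    qed
    then show "AE x\<in>{-1<..<1} in lborel. norm (poly f x * weight lam z x)
        \<le> norm (B * (1 - x\<^sup>2) powr (lam - 1/2))"
      by auto
  qed
qed

lemma weighted_integral_add:
  assumes "lam > -1/2" "z \<ge> 0"
  shows "weighted_integral lam z (f + h) = weighted_integral lam z f + weighted_integral lam z h"
  unfolding weighted_integral_def poly_add distrib_right
  by (intro set_integral_add integrable_poly_weight assms)

lemma weighted_integral_smult:
  "weighted_integral lam z (smult c f) = c * weighted_integral lam z f"
  unfolding weighted_integral_def poly_smult mult.assoc by simp

text \<open>If the integral were 0, almost every point of the interval would be a root of
  \<open>q\<close>, but the roots are finitely many. Nonnegativity on the interval, rather than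
  being a square, is assumed so that the lemma also applies at the endpoint argument for the
  zeros.\<close>

lemma weighted_integral_pos:
  assumes "lam > -1/2" "z \<ge> 0" "q \<noteq> 0" and nonneg: "\<And>x. x \<in> {-1<..<1} \<Longrightarrow> poly q x \<ge> 0"
  shows "weighted_integral lam z q > 0"
proof -
  define F where "F x = indicator {-1<..<1} x *\<^sub>R (poly q x * weight lam z x)" for x
  have int: "integrable lborel F"
    using integrable_poly_weight[OF assms(1,2)] by (simp add: set_integrable_def F_def[abs_def])
  have F0: "F x \<ge> 0" for x
    using nonneg[of x] weight_nonneg[of lam z x] by (auto simp: F_def indicator_def)
  have "integral\<^sup>L lborel F \<noteq> 0"
  proof
    assume "integral\<^sup>L lborel F = 0"
    then have "AE x in lborel. F x = 0"
      using integral_nonneg_eq_0_iff_AE[OF int] F0 by simp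
    moreover have "AE x in lborel. x \<notin> {x. poly q x = 0}"
      using poly_roots_finite[OF assms(3)] by (intro AE_not_in finite_imp_null_set_lborel)
    ultimately have "AE x in lborel. x \<notin> {-1<..<1::real}"
    proof eventually_elim
      case (elim x)
      then show ?case
        using weight_pos[of x lam z] by (auto simp: F_def indicator_def split: if_splits)
    qed
    then have "emeasure lborel {-1<..<1::real} = 0"
      by (subst (asm) AE_iff_measurable[of "{-1<..<1}"]) auto
    then show False
      by simp
  qed
  moreover have "integral\<^sup>L lborel F \<ge> 0"
    using F0 by simp
  ultimately show ?thesis
    by (simp add: weighted_integral_def set_lebesgue_integral_def F_def[abs_def])
qed

text \<open>Integration by parts for \<open>f w\<close> with the extra factor \<open>1 - x\<^sup>2\<close>: since \<open>lam + 1/2 > 0\<close>,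
  this factor kills the boundary terms even where the weight itself blows up.\<close>

lemma weighted_integral_pearson:
  assumes "lam > -1/2" "z \<ge> 0"
  shows "weighted_integral lam z ([:1, 0, -1:] * pderiv f)
    = weighted_integral lam z ([:0, 2 * lam + 1 + 2 * z, 0, - 2 * z:] * f)"
proof -
  \<comment> \<open>The positive exponent makes \<open>G\<close> continuous up to the endpoints,
    with value 0 there; \<open>h\<close> is its derivative divided by the weight.\<close>
  define G where "G x = (1 - x\<^sup>2) powr (lam + 1/2) * exp (- z * x\<^sup>2) * poly f x" for x
  define h where "h = [:1, 0, -1:] * pderiv f - [:0, 2 * lam + 1 + 2 * z, 0, - 2 * z:] * f"
  have "((\<lambda>x. poly h x * weight lam z x) has_integral G 1 - G (-1)) {-1..1}"
  proof (rule fundamental_theorem_of_calculus_interior)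
    have "x\<^sup>2 \<le> 1" if "x \<in> {-1..1}" for x :: real
      using that by (auto simp: abs_square_le_1)
    then show "continuous_on {-1..1} G"
      unfolding G_def using assms by (intro continuous_intros continuous_on_powr') auto
    fix x :: real assume x: "x \<in> {-1<..<1}"
    have pos: "1 - x\<^sup>2 > 0"
      using square_less_1[OF x] by simp
    have powr: "(1 - x\<^sup>2) powr (lam + 1/2) = (1 - x\<^sup>2) * (1 - x\<^sup>2) powr (lam - 1/2)"
      using pos powr_add[of "1 - x\<^sup>2" 1 "lam - 1/2"] by (simp add: add.commute)
    have "(G has_real_derivative
        (lam + 1/2) * (1 - x\<^sup>2) powr (lam - 1/2) * (- 2 * x) * exp (- z * x\<^sup>2) * poly f x
        + (1 - x\<^sup>2) powr (lam + 1/2) * (exp (- z * x\<^sup>2) * (- z * (2 * x))) * poly f x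
        + (1 - x\<^sup>2) powr (lam + 1/2) * exp (- z * x\<^sup>2) * poly (pderiv f) x) (at x)"
      unfolding G_def using pos
      by (auto intro!: derivative_eq_intros DERIV_powr poly_DERIV simp: powr_diff field_simps)
    also have "(lam + 1/2) * (1 - x\<^sup>2) powr (lam - 1/2) * (- 2 * x) * exp (- z * x\<^sup>2) * poly f x
        + (1 - x\<^sup>2) powr (lam + 1/2) * (exp (- z * x\<^sup>2) * (- z * (2 * x))) * poly f x
        + (1 - x\<^sup>2) powr (lam + 1/2) * exp (- z * x\<^sup>2) * poly (pderiv f) x
        = poly h x * weight lam z x"
      unfolding powr weight_def h_def
      by (simp add: algebra_simps power2_eq_square)
    finally show "(G has_vector_derivative poly h x * weight lam z x) (at x)"
      by (simp add: has_real_derivative_iff_has_vector_derivative)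
  qed simp
  then have "integral {-1<..<1} (\<lambda>x. poly h x * weight lam z x) = 0"
    by (intro integral_unique) (simp add: has_integral_Icc_iff_Ioo G_def)
  then have "weighted_integral lam z h = 0"
    unfolding weighted_integral_def
    using set_borel_integral_eq_integral(2)[OF integrable_poly_weight[OF assms]] by simp
  then show ?thesis
    using weighted_integral_add[OF assms, of h "[:0, 2 * lam + 1 + 2 * z, 0, - 2 * z:] * f"]
    by (simp only: h_def diff_add_cancel)
qed

section \<open>Differentiation of a weighted integral in the parameter\<close>

lemma exp_minus_remainder:
  assumes "d \<ge> -1/2"
  shows "\<bar>exp (- d) - 1 + d\<bar> \<le> 2 * (d::real)\<^sup>2"
proof -
  \<comment> \<open>Both bounds come from \<open>exp t\<close> being at least \<open>1 + t\<close>: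
    at \<open>t = d\<close> for the upper one, at \<open>t = - d\<close> for the lower one.\<close>
  have "exp (- d) \<le> 1 / (1 + d)"
    using exp_ge_add_one_self[of d] assms by (simp add: exp_minus field_simps)
  also have "1 / (1 + d) = 1 - d + d\<^sup>2 / (1 + d)"
    using assms by (simp add: field_simps power2_eq_square)
  also have "d\<^sup>2 / (1 + d) \<le> d\<^sup>2 / (1/2)"
    using assms by (intro divide_left_mono) auto
  finally show ?thesis
    using exp_ge_add_one_self[of "- d"] by simp
qed

text \<open>Passing from \<open>z\<close> to \<open>s\<close> multiplies the weight by
  \<open>exp (- (s - z) x^2)\<close>. Its first-order remainder is bounded by
  \<open>2 (s - z)^2\<close> uniformly on the interval, so after integration the error is quadratic
  in \<open>s - z\<close>.\<close>

lemma weighted_integral_has_derivative: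
  assumes "lam > -1/2" "z > 0"
  shows "((\<lambda>s. weighted_integral lam s f) has_real_derivative
    - weighted_integral lam z ([:0, 0, 1:] * f)) (at z)"
proof -
  define I where "I = (LBINT x:{-1<..<1}. 2 * \<bar>poly f x * weight lam z x\<bar>)"
  have bound: "\<bar>weighted_integral lam s f - weighted_integral lam z f
      + (s - z) * weighted_integral lam z ([:0, 0, 1:] * f)\<bar> \<le> I * (s - z)\<^sup>2"
    if "s > 0" "\<bar>s - z\<bar> \<le> 1/2" for s
  proof -
    define F where "F x = poly f x * weight lam s x - poly f x * weight lam z x
      + (s - z) * (poly ([:0, 0, 1:] * f) x * weight lam z x)" for x
    have int: "set_integrable lborel {-1<..<1} (\<lambda>x. poly q x * weight lam t x)" if "t > 0" for q t
      using assms that by (intro integrable_poly_weight) auto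
    have "weighted_integral lam s f - weighted_integral lam z f
        + (s - z) * weighted_integral lam z ([:0, 0, 1:] * f) = (LBINT x:{-1<..<1}. F x)"
      unfolding weighted_integral_def F_def
      using int[OF \<open>s > 0\<close>, of f] int[OF \<open>z > 0\<close>, of f]
        set_integrable_mult_right[OF int[OF \<open>z > 0\<close>], of "s - z" "[:0, 0, 1:] * f"]
      by (simp only: set_integral_add(2) set_integral_diff(2) set_integral_diff(1)
          set_integral_mult_right)
    also have "\<bar>\<dots>\<bar> \<le> (LBINT x:{-1<..<1}. 2 * \<bar>poly f x * weight lam z x\<bar> * (s - z)\<^sup>2)"
      unfolding set_lebesgue_integral_def real_norm_def[symmetric]
    proof (rule order_trans[OF integral_norm_bound integral_mono], rule integrable_norm)
      show "integrable lborel (\<lambda>x. indicator {-1<..<1} x *\<^sub>R F x)"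
        unfolding F_def set_integrable_def[symmetric]
        by (intro set_integral_add set_integral_diff set_integrable_mult_right int
            \<open>s > 0\<close> \<open>z > 0\<close>)
      show "integrable lborel (\<lambda>x. indicator {-1<..<1} x *\<^sub>R
          (2 * norm (poly f x * weight lam z x) * (s - z)\<^sup>2))"
        unfolding set_integrable_def[symmetric]
        using set_integrable_norm[OF int[OF \<open>z > 0\<close>]] by auto
      fix x :: real
      show "norm (indicator {-1<..<1} x *\<^sub>R F x) \<le> indicator {-1<..<1} x *\<^sub>R
          (2 * norm (poly f x * weight lam z x) * (s - z)\<^sup>2)"
      proof (cases "x \<in> {-1<..<1}")
        case True
        define d where "d = (s - z) * x\<^sup>2"
        have x2: "x\<^sup>2 \<le> 1"
          using square_less_1[OF True] by simp
        have "\<bar>d\<bar> \<le> \<bar>s - z\<bar> * 1"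
          unfolding d_def abs_mult by (intro mult_left_mono) (use x2 in auto)
        then have d: "d \<ge> -1/2" and d2: "d\<^sup>2 \<le> (s - z)\<^sup>2"
          using that(2) unfolding abs_le_square_iff[symmetric] by (simp_all, linarith)
        have "weight lam s x = weight lam z x * exp (- d)"
          by (simp add: weight_def d_def exp_add[symmetric] algebra_simps)
        then have "F x = poly f x * weight lam z x * (exp (- d) - 1 + d)"
          by (simp add: F_def d_def algebra_simps power2_eq_square)
        then have "\<bar>F x\<bar> = \<bar>poly f x * weight lam z x\<bar> * \<bar>exp (- d) - 1 + d\<bar>"
          by (simp add: abs_mult)
        also have "\<dots> \<le> \<bar>poly f x * weight lam z x\<bar> * (2 * (s - z)\<^sup>2)"
          using exp_minus_remainder[OF d] d2 by (intro mult_left_mono) auto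
        finally show ?thesis
          using True by (simp add: mult_ac)
      qed auto
    qed
    also have "\<dots> = I * (s - z)\<^sup>2"
      by (simp add: I_def)
    finally show ?thesis .
  qed
  have "(\<lambda>h. (weighted_integral lam (z + h) f - weighted_integral lam z f) / h) \<midarrow>0\<rightarrow>
      - weighted_integral lam z ([:0, 0, 1:] * f)"
  proof (rule LIM_zero_cancel, rule Lim_null_comparison)
    have "((\<lambda>h. I * \<bar>h\<bar>) \<longlongrightarrow> I * \<bar>0\<bar>) (at 0)"
      by (intro tendsto_intros)
    then show "((\<lambda>h. I * \<bar>h\<bar>) \<longlongrightarrow> 0) (at 0)"
      by simp
    show "\<forall>\<^sub>F h in at 0. norm ((weighted_integral lam (z + h) f - weighted_integral lam z f) / h
        - - weighted_integral lam z ([:0, 0, 1:] * f)) \<le> I * \<bar>h\<bar>"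
      unfolding eventually_at
    \<comment> \<open>The radius \<open>1/2\<close> is the range of the remainder estimate, and
      \<open>z\<close> keeps \<open>z + h\<close> positive.\<close>
    proof (intro exI[of _ "min (1/2) z"] conjI ballI impI)
      fix h :: real assume h: "h \<noteq> 0 \<and> dist h 0 < min (1/2) z"
      define W where "W = weighted_integral lam (z + h) f - weighted_integral lam z f
        + h * weighted_integral lam z ([:0, 0, 1:] * f)"
      have "z + h > 0" "\<bar>z + h - z\<bar> \<le> 1/2"
        using h by (auto simp: dist_real_def)
      from bound[OF this] have "\<bar>W\<bar> \<le> I * h\<^sup>2"
        by (simp add: W_def)
      then have "\<bar>W\<bar> / \<bar>h\<bar> \<le> I * h\<^sup>2 / \<bar>h\<bar>"
        by (intro divide_right_mono) auto
      also have "I * h\<^sup>2 / \<bar>h\<bar> = I * \<bar>h\<bar>"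
        using h by (simp add: power2_eq_square abs_if)
      finally have "\<bar>W / h\<bar> \<le> I * \<bar>h\<bar>"
        by simp
      moreover have "W / h = (weighted_integral lam (z + h) f - weighted_integral lam z f) / h
        - - weighted_integral lam z ([:0, 0, 1:] * f)"
        using h by (simp add: W_def field_simps)
      ultimately show "norm ((weighted_integral lam (z + h) f - weighted_integral lam z f) / h
        - - weighted_integral lam z ([:0, 0, 1:] * f)) \<le> I * \<bar>h\<bar>"
        by simp
    qed (use assms in auto)
  qed
  then show ?thesis
    by (simp add: DERIV_def)
qed

subsection \<open>Dependence of the polynomials on the parameter\<close>

lemma pearson_functional_weighted_integral:
  assumes "lam > -1/2" "z > 0" "monic_orthogonal lam z p" "has_recurrence p g"
  shows "pearson_functional (weighted_integral lam z) lam z p g"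
proof
  show "f \<noteq> 0 \<Longrightarrow> weighted_integral lam z (f * f) > 0" for f
    using assms(1,2) by (intro weighted_integral_pos) auto
  show "m \<noteq> k \<Longrightarrow> weighted_integral lam z (p m * p k) = 0" for m k
    using assms(3) by (simp add: monic_orthogonal_def weighted_integral_def)
  show "degree (p m) = m" "lead_coeff (p m) = 1" for m
    using assms(3) unfolding monic_orthogonal_def by blast+
qed (use assms(1,2,4) weighted_integral_pearson[of lam z] weighted_integral_add[of lam z]
      weighted_integral_smult in auto)

section \<open>Product rule for integrals of polynomial families\<close>

lemma weighted_integral_sum:
  assumes "lam > -1/2" "z \<ge> 0" "finite A"
  shows "weighted_integral lam z (\<Sum>i\<in>A. f i) = (\<Sum>i\<in>A. weighted_integral lam z (f i))"
  using assms(3)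
proof (induction A rule: finite_induct)
  case empty
  then show ?case by (simp add: weighted_integral_def)
next
  case (insert i A)
  then show ?case by (simp add: weighted_integral_add[OF assms(1,2)])
qed

text \<open>This separates the two dependences on the parameter: the coefficients carry that of the
  polynomial, the moments that of the weight.\<close>

lemma weighted_integral_mult_monoms:
  assumes "lam > -1/2" "z \<ge> 0" "degree f \<le> d"
  shows "weighted_integral lam z (h * f)
    = (\<Sum>i\<le>d. coeff f i * weighted_integral lam z (h * monom 1 i))"
proof -
  have "h * f = (\<Sum>i\<le>d. smult (coeff f i) (h * monom 1 i))"
    by (subst poly_as_sum_of_monoms'[OF assms(3), symmetric])
       (simp add: sum_distrib_left smult_monom flip: mult_smult_right)
  then show ?thesis
    by (simp add: weighted_integral_sum[OF assms(1,2)] weighted_integral_smult)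
qed

text \<open>The derivative is recorded as a polynomial, so that it can itself be integrated against
  the weight and tested for orthogonality.\<close>

definition has_coeff_derivative :: "(real \<Rightarrow> real poly) \<Rightarrow> real poly \<Rightarrow> real \<Rightarrow> bool" where
  "has_coeff_derivative f f' z \<longleftrightarrow>
     (\<forall>i. ((\<lambda>s. coeff (f s) i) has_real_derivative coeff f' i) (at z))"

lemma has_coeff_derivative_const: "has_coeff_derivative (\<lambda>s. c) 0 z"
  by (simp add: has_coeff_derivative_def)

lemma has_coeff_derivative_transform:
  assumes "has_coeff_derivative f f' z" "z > 0" "\<And>s. s > 0 \<Longrightarrow> f s = h s"
  shows "has_coeff_derivative h f' z"
  unfolding has_coeff_derivative_def
proof
  fix i
  show "((\<lambda>s. coeff (h s) i) has_real_derivative coeff f' i) (at z)"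
    by (rule has_field_derivative_transform_within_open[of "\<lambda>s. coeff (f s) i" _ _ "{0<..}"])
       (use assms in \<open>auto simp: has_coeff_derivative_def\<close>)
qed

lemma has_coeff_derivative_diff:
  assumes "has_coeff_derivative f f' z" "has_coeff_derivative h h' z"
  shows "has_coeff_derivative (\<lambda>s. f s - h s) (f' - h') z"
  using assms unfolding has_coeff_derivative_def by (auto intro!: derivative_intros)

lemma has_coeff_derivative_mult:
  assumes "has_coeff_derivative f f' z" "has_coeff_derivative h h' z"
  shows "has_coeff_derivative (\<lambda>s. f s * h s) (f' * h z + f z * h') z"
  unfolding has_coeff_derivative_def
proof
  fix n
  have "((\<lambda>s. \<Sum>i\<le>n. coeff (f s) i * coeff (h s) (n - i)) has_real_derivative
      (\<Sum>i\<le>n. coeff (f z) i * coeff h' (n - i) + coeff f' i * coeff (h z) (n - i))) (at z)"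
    using assms unfolding has_coeff_derivative_def by (intro DERIV_sum DERIV_mult') auto
  then show "((\<lambda>s. coeff (f s * h s) n) has_real_derivative coeff (f' * h z + f z * h') n) (at z)"
    by (simp add: coeff_mult sum.distrib add.commute)
qed

lemma has_coeff_derivative_smult:
  assumes "(c has_real_derivative c') (at z)" "has_coeff_derivative f f' z"
  shows "has_coeff_derivative (\<lambda>s. smult (c s) (f s)) (smult c' (f z) + smult (c z) f') z"
  using assms unfolding has_coeff_derivative_def
  by (auto intro!: derivative_eq_intros)

text \<open>This bounds the degree of the derivative: \<open>c = 0\<close> above the degree of the
  family, \<open>c = 1\<close> at the leading coefficient of a monic one.\<close>

lemma has_coeff_derivative_coeff_eq_0:
  assumes "has_coeff_derivative f f' z" "z > 0" "\<And>s. s > 0 \<Longrightarrow> coeff (f s) i = c"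
  shows "coeff f' i = 0"
proof -
  have "((\<lambda>s. coeff (f s) i) has_real_derivative 0) (at z)"
    by (rule has_field_derivative_transform_within_open[of "\<lambda>s. c" _ _ "{0<..}"])
       (use assms in auto)
  then show ?thesis
    using assms(1) DERIV_unique unfolding has_coeff_derivative_def by blast
qed

lemma weighted_integral_family_has_derivative:
  assumes "lam > -1/2" "z > 0" "has_coeff_derivative f f' z"
    and deg: "\<And>s. s > 0 \<Longrightarrow> degree (f s) \<le> d"
  shows "((\<lambda>s. weighted_integral lam s (f s)) has_real_derivative
    weighted_integral lam z f' - weighted_integral lam z ([:0, 0, 1:] * f z)) (at z)"
proof -
  have deg': "degree f' \<le> d"
  proof (rule degree_le, intro allI impI)
    show "coeff f' i = 0" if "d < i" for i
      by (rule has_coeff_derivative_coeff_eq_0[where c = 0, OF assms(3,2)])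
         (rule coeff_eq_0, rule le_less_trans[OF deg that])
  qed
  let ?W = "\<lambda>s i. weighted_integral lam s (monom 1 i)"
  have "((\<lambda>s. \<Sum>i\<le>d. coeff (f s) i * ?W s i) has_real_derivative
      (\<Sum>i\<le>d. coeff f' i * ?W z i
        + - weighted_integral lam z ([:0, 0, 1:] * monom 1 i) * coeff (f z) i)) (at z)"
    using assms(3) weighted_integral_has_derivative[OF assms(1,2)]
    unfolding has_coeff_derivative_def by (intro DERIV_sum DERIV_mult) auto
  also have "(\<Sum>i\<le>d. coeff f' i * ?W z i
        + - weighted_integral lam z ([:0, 0, 1:] * monom 1 i) * coeff (f z) i)
      = weighted_integral lam z f' - weighted_integral lam z ([:0, 0, 1:] * f z)"
    using weighted_integral_mult_monoms[OF assms(1) _ deg', of z 1] assms(2)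
      weighted_integral_mult_monoms[OF assms(1) _ deg, of z z "[:0, 0, 1:]"]
    by (simp add: sum.distrib sum_negf sum_subtractf mult.commute del: mult_pCons_left)
  finally show ?thesis
    by (rule has_field_derivative_transform_within_open[of _ _ _ "{0<..}"])
       (use assms(2) weighted_integral_mult_monoms[OF assms(1) _ deg, of _ _ 1] in auto)
qed

text \<open>Induction along the recurrence, on two consecutive indices because it has three terms.
  The norms are differentiable by the product rule for integrals, hence so is their quotient, the
  recurrence coefficient.\<close>

lemma orthogonal_has_coeff_derivative:
  assumes "lam > -1/2" "z > 0"
    and "\<And>z. z > 0 \<Longrightarrow> monic_orthogonal lam z (\<lambda>m. P m z)"
    and "\<And>z. z > 0 \<Longrightarrow> has_recurrence (\<lambda>m. P m z) (\<lambda>m. gam m z)"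
  shows "\<exists>f'. has_coeff_derivative (P m) f' z"
proof -
  have pf: "pearson_functional (weighted_integral lam s) lam s (\<lambda>m. P m s) (\<lambda>m. gam m s)"
    if "s > 0" for s
    using pearson_functional_weighted_integral[of lam s "\<lambda>m. P m s" "\<lambda>m. gam m s"] assms that
    by blast
  have "(\<exists>f'. has_coeff_derivative (P m) f' z) \<and> (\<exists>f'. has_coeff_derivative (P (Suc m)) f' z)"
  proof (induction m)
    case 0
    have P0: "P 0 s = 1" if "s > 0" for s
    proof -
      have "degree (P 0 s) = 0" "coeff (P 0 s) 0 = 1"
        using pearson_functional.degree_p[OF pf[OF that], of 0]
          pearson_functional.coeff_p_top[OF pf[OF that], of 0] by auto
      then show ?thesis
        by (metis coeff_pCons_0 degree_eq_zeroE one_pCons)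
    qed
    have P1: "P (Suc 0) s = [:0, 1:]" if "s > 0" for s
    proof -
      have "[:0, 1:] * P 0 s = P (Suc 0) s"
        using spec[OF assms(4)[OF that, unfolded has_recurrence_def], of 0] by simp
      then show ?thesis
        by (simp add: P0[OF that])
    qed
    show ?case
      using has_coeff_derivative_transform[OF has_coeff_derivative_const assms(2)] P0 P1
      by metis
  next
    case (Suc m)
    then obtain f0 f1 where f0: "has_coeff_derivative (P m) f0 z"
      and f1: "has_coeff_derivative (P (Suc m)) f1 z"
      by blast
    have norm: "\<exists>h'. ((\<lambda>s. weighted_integral lam s (P k s * P k s)) has_real_derivative h') (at z)"
      if "has_coeff_derivative (P k) f' z" for k f'
    proof -
      have "degree (P k s * P k s) \<le> k + k" if "s > 0" for s
        using degree_mult_le[of "P k s" "P k s"] assms(3)[OF that]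
        by (simp add: monic_orthogonal_def)
      then show ?thesis
        using weighted_integral_family_has_derivative[OF assms(1,2)
            has_coeff_derivative_mult[OF that that]] by blast
    qed
    obtain h0 h1
      where h0: "((\<lambda>s. weighted_integral lam s (P m s * P m s)) has_real_derivative h0) (at z)"
        and h1: "((\<lambda>s. weighted_integral lam s (P (Suc m) s * P (Suc m) s))
          has_real_derivative h1) (at z)"
      using norm[OF f0] norm[OF f1] by blast
    define c where "c s = weighted_integral lam s (P (Suc m) s * P (Suc m) s)
      / weighted_integral lam s (P m s * P m s)" for s
    have "weighted_integral lam z (P m z * P m z) \<noteq> 0"
      using pearson_functional.norm_pos[OF pf[OF assms(2)], of m] by simp
    then obtain c' where c': "(c has_real_derivative c') (at z)"
      unfolding c_def using DERIV_divide[OF h1 h0] by blast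
    have eq: "[:0, 1:] * P (Suc m) s - smult (c s) (P m s) = P (Suc (Suc m)) s" if "s > 0" for s
    proof -
      have "c s = gam (Suc m) s"
        unfolding c_def pearson_functional.norm_Suc[OF pf[OF that]]
        using pearson_functional.norm_pos[OF pf[OF that], of m] by simp
      then show ?thesis
        unfolding pearson_functional.recurrence_Suc[OF pf[OF that]] by simp
    qed
    have "\<exists>f'. has_coeff_derivative (P (Suc (Suc m))) f' z"
      by (rule exI, rule has_coeff_derivative_transform[OF has_coeff_derivative_diff[OF
            has_coeff_derivative_mult[OF has_coeff_derivative_const f1]
            has_coeff_derivative_smult[OF c' f0]] assms(2) eq])
    then show ?case
      using f1 by blast
  qed
  then show ?thesis ..
qed

text \<open>Differentiating the vanishing integral of \<open>P (Suc N) s * q\<close> for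
  \<open>q\<close> of degree at most \<open>N\<close> gives the hypothesis of
  \<open>deformation_relation\<close>; monicity gives the degree bound.\<close>

lemma orthogonal_coeff_derivative:
  assumes "lam > -1/2" "z > 0"
    and "\<And>z. z > 0 \<Longrightarrow> monic_orthogonal lam z (\<lambda>m. P m z)"
    and "\<And>z. z > 0 \<Longrightarrow> has_recurrence (\<lambda>m. P m z) (\<lambda>m. gam m z)"
  shows "has_coeff_derivative (P (Suc N))
    (smult (gam (Suc N) z) ([:0, 1:] * P N z - P (Suc N) z)) z"
proof -
  have pf: "pearson_functional (weighted_integral lam s) lam s (\<lambda>m. P m s) (\<lambda>m. gam m s)"
    if "s > 0" for s
    using pearson_functional_weighted_integral[of lam s "\<lambda>m. P m s" "\<lambda>m. gam m s"] assms that
    by blast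
  have deg: "degree (P (Suc N) s) = Suc N" and top: "coeff (P (Suc N) s) (Suc N) = 1"
    if "s > 0" for s
    using pearson_functional.degree_p[OF pf[OF that]] pearson_functional.coeff_p_top[OF pf[OF that]]
    by auto
  obtain d where d: "has_coeff_derivative (P (Suc N)) d z"
    using orthogonal_has_coeff_derivative[OF assms] by blast
  have "coeff d i = 0" if "i > N" for i
  proof (cases "i = Suc N")
    case True
    then show ?thesis
      using has_coeff_derivative_coeff_eq_0[OF d assms(2)] top by blast
  next
    case False
    then show ?thesis
      using has_coeff_derivative_coeff_eq_0[OF d assms(2), of i 0] deg that
      by (simp add: coeff_eq_0)
  qed
  then have "degree d \<le> N"
    by (intro degree_le) auto
  moreover have "weighted_integral lam z (d * q)
      = weighted_integral lam z ([:0, 0, 1:] * P (Suc N) z * q)" if q: "degree q \<le> N" for q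
  proof -
    have "degree (P (Suc N) s * q) \<le> Suc N + N" if "s > 0" for s
      using degree_mult_le[of "P (Suc N) s" q] deg[OF that] q by simp
    then have "((\<lambda>s. weighted_integral lam s (P (Suc N) s * q)) has_real_derivative
        weighted_integral lam z (d * q + P (Suc N) z * 0)
        - weighted_integral lam z ([:0, 0, 1:] * (P (Suc N) z * q))) (at z)"
      by (rule weighted_integral_family_has_derivative[OF assms(1,2)
            has_coeff_derivative_mult[OF d has_coeff_derivative_const]])
    moreover have "weighted_integral lam s (P (Suc N) s * q) = 0" if "s > 0" for s
      using pearson_functional.L_p_mult[OF pf[OF that], of q "Suc N"] q by (simp add: coeff_eq_0)
    then have "((\<lambda>s. weighted_integral lam s (P (Suc N) s * q)) has_real_derivative 0) (at z)"
      using has_field_derivative_transform_within_open[OF DERIV_const[of 0 "at z"], of "{0<..}"] assms(2)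
      by simp
    ultimately have "weighted_integral lam z (d * q + P (Suc N) z * 0)
        - weighted_integral lam z ([:0, 0, 1:] * (P (Suc N) z * q)) = 0"
      by (rule DERIV_unique)
    then show ?thesis
      by (simp only: mult.assoc) simp
  qed
  ultimately have "d = smult (gam (Suc N) z) ([:0, 1:] * P N z - P (Suc N) z)"
    by (rule pearson_functional.deformation_relation[OF pf[OF assms(2)]])
  then show ?thesis
    using d by simp
qed

text \<open>If \<open>P\<^sub>n = (x - t) R\<close> with \<open>t = 1\<close> or \<open>t = -1\<close>, then \<open>- t (x - t) R\<^sup>2\<close> is nonnegative on the
  interval, although \<open>P\<^sub>n\<close> is orthogonal to \<open>R\<close>.\<close>

lemma orthogonal_nonzero_at_endpoint:
  assumes "lam > -1/2" "z > 0" "monic_orthogonal lam z p" "has_recurrence p g" "t\<^sup>2 = 1"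
  shows "poly (p (Suc N)) t \<noteq> 0"
proof
  interpret pearson_functional "weighted_integral lam z" lam z p g
    by (rule pearson_functional_weighted_integral[OF assms(1-4)])
  assume "poly (p (Suc N)) t = 0"
  then obtain R where R: "p (Suc N) = [:-t, 1:] * R"
    by (auto simp: poly_eq_0_iff_dvd dvd_def)
  then have "R \<noteq> 0"
    using p_nonzero[of "Suc N"] by auto
  then have "degree R = N"
    using degree_p[of "Suc N"] by (simp add: R degree_mult_eq del: mult_pCons_left)
  then have "weighted_integral lam z (p (Suc N) * R) = 0"
    using L_p_mult[of R "Suc N"] by (simp add: coeff_eq_0)
  moreover have "weighted_integral lam z (smult (-t) (p (Suc N) * R)) > 0"
  proof (rule weighted_integral_pos[OF assms(1)])
    show "smult (-t) (p (Suc N) * R) \<noteq> 0"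
      using \<open>R \<noteq> 0\<close> p_nonzero[of "Suc N"] assms(5) by auto
    fix x :: real assume "x \<in> {-1<..<1}"
    then have "(-t) * (x - t) \<ge> 0"
      using assms(5) by (auto simp: power2_eq_1_iff)
    then have "(-t) * (x - t) * (poly R x)\<^sup>2 \<ge> 0"
      by (rule mult_nonneg_nonneg) simp
    then show "poly (smult (-t) (p (Suc N) * R)) x \<ge> 0"
      by (simp add: R power2_eq_square algebra_simps)
  qed (use assms in auto)
  ultimately show False
    by (simp only: L_smult)
qed

subsection \<open>Motion of the zeros\<close>

text \<open>Counting the images of \<open>{1..j}\<close> gives that \<open>j\<close> is at most
  \<open>f j\<close>; counting those of \<open>{j..n}\<close> gives the converse.\<close>

lemma strict_mono_on_interval_self:
  fixes f :: "nat \<Rightarrow> nat"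
  assumes mono: "\<And>i j. i \<in> {1..n} \<Longrightarrow> j \<in> {1..n} \<Longrightarrow> i < j \<Longrightarrow> f i < f j"
    and range: "\<And>i. i \<in> {1..n} \<Longrightarrow> f i \<in> {1..n}" and j: "j \<in> {1..n}"
  shows "f j = j"
proof -
  have inj: "inj_on f {1..n}"
    using mono by (metis inj_onI linorder_neqE_nat less_irrefl)
  have le: "f i \<le> f j'" if "i \<in> {1..n}" "j' \<in> {1..n}" "i \<le> j'" for i j'
    using mono[of i j'] that by (cases "i = j'") auto
  have "f ` {1..j} \<subseteq> {1..f j}"
    using le range j by fastforce
  then have "card (f ` {1..j}) \<le> f j"
    using card_mono[of "{1..f j}"] by simp
  moreover have "card (f ` {1..j}) = j"
    using inj j by (subst card_image) (auto intro: inj_on_subset)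
  moreover have "f ` {j..n} \<subseteq> {f j..n}"
    using le range j by fastforce
  then have "card (f ` {j..n}) \<le> Suc n - f j"
    using card_mono[of "{f j..n}"] by simp
  moreover have "card (f ` {j..n}) = Suc n - j"
    using inj j by (subst card_image) (auto intro: inj_on_subset)
  ultimately show ?thesis
    using j range[OF j] by auto
qed

text \<open>Both sides are monic of degree \<open>n\<close> and vanish at the \<open>n\<close>
  distinct points \<open>y i\<close>.\<close>

lemma zeros_in_order_factorization:
  assumes "zeros_in_order n q y" "degree q = n" "lead_coeff q = 1"
  shows "q = (\<Prod>i\<in>{1..n}. [:- y i, 1:])"
proof (rule poly_eqI_degree_lead_coeff[where n = n and A = "y ` {1..n}"])
  have inj: "inj_on y {1..n}"
    using assms(1) by (simp add: zeros_in_order_def strict_mono_on_imp_inj_on)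
  have deg: "degree (\<Prod>i\<in>{1..n}. [:- y i, 1:]) = n"
    by (subst degree_prod_eq_sum_degree) auto
  then show "degree (\<Prod>i\<in>{1..n}. [:- y i, 1:]) \<le> n"
    by simp
  have "lead_coeff (\<Prod>i\<in>{1..n}. [:- y i, 1:]) = 1"
    by (simp add: lead_coeff_prod)
  then show "coeff q n = coeff (\<Prod>i\<in>{1..n}. [:- y i, 1:]) n"
    using assms(2,3) deg by simp
  show "card (y ` {1..n}) \<ge> n"
    unfolding card_image[OF inj] by simp
  show "poly q t = poly (\<Prod>i\<in>{1..n}. [:- y i, 1:]) t" if "t \<in> y ` {1..n}" for t
  proof -
    have "poly q t = 0"
      using assms(1) that by (auto simp: zeros_in_order_def)
    moreover have "poly (\<Prod>i\<in>{1..n}. [:- y i, 1:]) t = 0"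
      using that by (auto simp: poly_prod)
    ultimately show ?thesis
      by simp
  qed
qed (use assms in auto)

text \<open>By the factorization, \<open>\<bar>q\<^sub>s(x\<^sub>j(z))\<bar>\<close> is the product of the distances from \<open>x\<^sub>j(z)\<close> to the zeros
  of \<open>q\<^sub>s\<close>, so some zero of \<open>q\<^sub>s\<close> is close to \<open>x\<^sub>j(z)\<close>. The intervals around the \<open>x\<^sub>j(z)\<close> being disjoint,
  the index of that zero increases strictly with \<open>j\<close>, hence equals \<open>j\<close>.\<close>

lemma zeros_continuous:
  assumes "z > 0" "has_coeff_derivative q d z"
    and deg: "\<And>s. s > 0 \<Longrightarrow> degree (q s) = n" and lead: "\<And>s. s > 0 \<Longrightarrow> lead_coeff (q s) = 1"
    and zeros: "\<And>s. s > 0 \<Longrightarrow> zeros_in_order n (q s) (\<lambda>k. x k s)"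
    and k: "k \<in> {1..n}"
  shows "((\<lambda>s. x k s) \<longlongrightarrow> x k z) (at z)"
proof (rule tendstoI)
  have mono: "x i s < x j s \<longleftrightarrow> i < j" if "s > 0" "i \<in> {1..n}" "j \<in> {1..n}" for i j s
    using zeros[OF that(1)] strict_mono_on_less[of "{1..n}" "\<lambda>k. x k s" i j] that(2,3)
    unfolding zeros_in_order_def by blast
  fix e :: real assume "e > 0"
  \<comment> \<open>Half of every gap makes the \<delta>-intervals around the zeros at
    \<open>z\<close> disjoint; \<open>e\<close> gives the required precision and keeps
    \<open>S\<close> nonempty when \<open>n = 1\<close>.\<close>
  define S where "S = insert e ((\<lambda>(i, j). (x j z - x i z) / 2) ` {(i, j) \<in> {1..n} \<times> {1..n}. i < j})"
  define \<delta> where "\<delta> = Min S"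
  have "finite {(i, j) \<in> {1..n} \<times> {1..n}. i < j}"
    by (rule finite_subset[of _ "{1..n} \<times> {1..n}"]) auto
  then have S: "finite S" "S \<noteq> {}"
    unfolding S_def by blast+
  have "\<delta> > 0"
    unfolding \<delta>_def Min_gr_iff[OF S] using \<open>e > 0\<close> mono[OF assms(1)] by (auto simp: S_def)
  have "\<delta> \<le> e"
    unfolding \<delta>_def using S by (intro Min_le) (auto simp: S_def)
  have gap: "x i z + \<delta> \<le> x j z - \<delta>" if "i \<in> {1..n}" "j \<in> {1..n}" "i < j" for i j
  proof -
    have "\<delta> \<le> (x j z - x i z) / 2"
      unfolding \<delta>_def using S that by (intro Min_le) (auto simp: S_def)
    then show ?thesis
      by simp
  qed
  \<comment> \<open>The threshold is the least value that the product of \<open>n\<close> distances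
    could have if each were at least \<delta>.\<close>
  have "\<forall>\<^sub>F s in at z. \<bar>poly (q s) (x i z)\<bar> < \<delta> ^ n" if i: "i \<in> {1..n}" for i
  proof -
    have pos: "\<forall>\<^sub>F s in at z. s > 0"
      using assms(1) by (intro eventually_at_in_open'[of "{0<..}", simplified]) auto
    have "((\<lambda>s. \<Sum>m\<le>n. coeff (q s) m * x i z ^ m) \<longlongrightarrow> (\<Sum>m\<le>n. coeff (q z) m * x i z ^ m)) (at z)"
      using assms(2) unfolding has_coeff_derivative_def
      by (intro tendsto_intros) (metis DERIV_isCont isContD)
    moreover have "\<forall>\<^sub>F s in at z. (\<Sum>m\<le>n. coeff (q s) m * x i z ^ m) = poly (q s) (x i z)"
      using pos by eventually_elim (simp add: poly_altdef deg)
    ultimately have "((\<lambda>s. poly (q s) (x i z)) \<longlongrightarrow> (\<Sum>m\<le>n. coeff (q z) m * x i z ^ m)) (at z)"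
      by (rule Lim_transform_eventually)
    also have "(\<Sum>m\<le>n. coeff (q z) m * x i z ^ m) = poly (q z) (x i z)"
      by (simp add: poly_altdef deg[OF assms(1)])
    also have "poly (q z) (x i z) = 0"
      using zeros[OF assms(1)] i by (auto simp: zeros_in_order_def)
    finally have "((\<lambda>s. poly (q s) (x i z)) \<longlongrightarrow> 0) (at z)" .
    from tendstoD[OF this, of "\<delta> ^ n"] show ?thesis
      using \<open>\<delta> > 0\<close> by (simp add: dist_real_def)
  qed
  then have "\<forall>\<^sub>F s in at z. \<forall>i\<in>{1..n}. \<bar>poly (q s) (x i z)\<bar> < \<delta> ^ n"
    by (intro eventually_ball_finite) auto
  moreover have "\<forall>\<^sub>F s in at z. s > 0"
    using assms(1) by (intro eventually_at_in_open'[of "{0<..}", simplified]) auto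
  ultimately show "\<forall>\<^sub>F s in at z. dist (x k s) (x k z) < e"
  proof eventually_elim
    case (elim s)
    have "\<exists>i\<in>{1..n}. \<bar>x j z - x i s\<bar> < \<delta>" if j: "j \<in> {1..n}" for j
    proof (rule ccontr)
      assume "\<not> ?thesis"
      then have "(\<Prod>i\<in>{1..n}. \<delta>) \<le> (\<Prod>i\<in>{1..n}. \<bar>x j z - x i s\<bar>)"
        using \<open>\<delta> > 0\<close> by (intro prod_mono) (auto simp: not_less)
      also have "\<dots> = \<bar>poly (q s) (x j z)\<bar>"
        by (subst zeros_in_order_factorization[OF zeros[OF elim(2)] deg[OF elim(2)] lead[OF elim(2)]])
           (simp add: poly_prod abs_prod)
      finally show False
        using elim(1) j by force
    qed
    then obtain \<sigma> where \<sigma>: "\<And>j. j \<in> {1..n} \<Longrightarrow> \<sigma> j \<in> {1..n} \<and> \<bar>x j z - x (\<sigma> j) s\<bar> < \<delta>"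
      by metis
    have "\<sigma> i < \<sigma> j" if "i \<in> {1..n}" "j \<in> {1..n}" "i < j" for i j
    proof -
      have "x (\<sigma> i) s < x (\<sigma> j) s"
        using \<sigma>[OF that(1)] \<sigma>[OF that(2)] gap[OF that] by linarith
      then show ?thesis
        using mono[OF elim(2)] \<sigma> that by blast
    qed
    then have "\<sigma> k = k"
      using \<sigma> k by (intro strict_mono_on_interval_self[of n]) auto
    then show ?case
      using \<sigma>[OF k] \<open>\<delta> \<le> e\<close> by (simp add: dist_real_def abs_minus_commute)
  qed
qed

text \<open>An explicit implicit-function argument. With \<open>q z\<close> factored as
  \<open>(X - x k z) Q\<close>, the equation \<open>q s = 0\<close> at \<open>x k s\<close>
  expresses \<open>(x k s - x k z) Q(x k s)\<close> as minus the value of \<open>q s - q z\<close>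
  there. Division by \<open>s - z\<close> and continuity of the zero give the limit, where
  \<open>Q\<close> takes the value of the derivative of \<open>q z\<close>.\<close>

lemma zeros_have_derivative:
  assumes "z > 0" "has_coeff_derivative q d z"
    and deg: "\<And>s. s > 0 \<Longrightarrow> degree (q s) = n" and lead: "\<And>s. s > 0 \<Longrightarrow> lead_coeff (q s) = 1"
    and zeros: "\<And>s. s > 0 \<Longrightarrow> zeros_in_order n (q s) (\<lambda>k. x k s)"
    and k: "k \<in> {1..n}"
  shows "poly (pderiv (q z)) (x k z) \<noteq> 0"
    and "((\<lambda>s. x k s) has_real_derivative
      - poly d (x k z) / poly (pderiv (q z)) (x k z)) (at z)"
proof -
  define Q where "Q = (\<Prod>i\<in>{1..n} - {k}. [:- x i z, 1:])"
  have qz: "q z = [:- x k z, 1:] * Q"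
    unfolding Q_def zeros_in_order_factorization[OF zeros deg lead, OF assms(1) assms(1) assms(1)]
    using k by (subst prod.remove[of _ k]) auto
  have "x k z \<noteq> x i z" if "i \<in> {1..n} - {k}" for i
  proof -
    have "inj_on (\<lambda>k. x k z) {1..n}"
      using zeros[OF assms(1)] unfolding zeros_in_order_def by (blast intro: strict_mono_on_imp_inj_on)
    then show ?thesis
      using that k by (metis Diff_iff inj_onD singletonI)
  qed
  then have "\<forall>i\<in>{1..n} - {k}. poly [:- x i z, 1:] (x k z) \<noteq> 0"
    by simp
  then have Q0: "poly Q (x k z) \<noteq> 0"
    unfolding Q_def poly_prod by (subst prod_zero_iff) blast+
  have deriv: "poly (pderiv (q z)) (x k z) = poly Q (x k z)"
    unfolding qz pderiv_mult by (simp add: pderiv_pCons)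
  then show "poly (pderiv (q z)) (x k z) \<noteq> 0"
    using Q0 by simp
  have pos: "\<forall>\<^sub>F s in at z. s > 0"
    using assms(1) by (intro eventually_at_in_open'[of "{0<..}", simplified]) auto
  have cont: "((\<lambda>s. x k s) \<longlongrightarrow> x k z) (at z)"
    by (rule zeros_continuous[OF assms(1,2) deg lead zeros k])
  have degd: "degree d \<le> n"
  proof (rule degree_le, intro allI impI)
    show "coeff d i = 0" if "n < i" for i
      by (rule has_coeff_derivative_coeff_eq_0[where c = 0, OF assms(2,1)])
         (use deg that in \<open>simp add: coeff_eq_0\<close>)
  qed
  have "((\<lambda>s. - (\<Sum>i\<le>n. (coeff (q s) i - coeff (q z) i) / (s - z) * x k s ^ i) / poly Q (x k s))
      \<longlongrightarrow> - (\<Sum>i\<le>n. coeff d i * x k z ^ i) / poly Q (x k z)) (at z)"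
    using assms(2) Q0 cont unfolding has_coeff_derivative_def has_field_derivative_iff
    by (intro tendsto_intros) auto
  also have "(\<Sum>i\<le>n. coeff d i * x k z ^ i) = poly d (x k z)"
    by (subst (2) poly_as_sum_of_monoms'[OF degd, symmetric]) (simp add: poly_sum poly_monom)
  finally have lim: "((\<lambda>s. - (\<Sum>i\<le>n. (coeff (q s) i - coeff (q z) i) / (s - z) * x k s ^ i)
      / poly Q (x k s)) \<longlongrightarrow> - poly d (x k z) / poly (pderiv (q z)) (x k z)) (at z)"
    unfolding deriv .
  have "((\<lambda>s. poly Q (x k s)) \<longlongrightarrow> poly Q (x k z)) (at z)"
    using cont by (intro tendsto_intros)
  then have "\<forall>\<^sub>F s in at z. poly Q (x k s) \<noteq> 0"
    using Q0 by (rule tendsto_imp_eventually_ne)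
  moreover have "\<forall>\<^sub>F s in at z. s \<noteq> z"
    by (simp add: eventually_at_filter)
  ultimately have "\<forall>\<^sub>F s in at z.
      - (\<Sum>i\<le>n. (coeff (q s) i - coeff (q z) i) / (s - z) * x k s ^ i) / poly Q (x k s)
      = (x k s - x k z) / (s - z)"
    using pos
  proof eventually_elim
    case (elim s)
    have "poly (q s) (x k s) = 0"
      using zeros[OF elim(3)] k by (auto simp: zeros_in_order_def)
    then have "(\<Sum>i\<le>n. (coeff (q s) i - coeff (q z) i) * x k s ^ i) = - poly (q z) (x k s)"
      using deg[OF elim(3)] deg[OF assms(1)]
      by (simp add: poly_altdef sum_subtractf left_diff_distrib)
    also have "\<dots> = - ((x k s - x k z) * poly Q (x k s))"
      unfolding qz by (simp add: algebra_simps)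
    finally have "(\<Sum>i\<le>n. (coeff (q s) i - coeff (q z) i) / (s - z) * x k s ^ i)
        = - ((x k s - x k z) * poly Q (x k s)) / (s - z)"
      by (simp flip: sum_divide_distrib)
    then show ?case
      using elim by simp
  qed
  with lim show "((\<lambda>s. x k s) has_real_derivative
      - poly d (x k z) / poly (pderiv (q z)) (x k z)) (at z)"
    unfolding has_field_derivative_iff by (rule Lim_transform_eventually)
qed

section \<open>Combination of the two identities at a zero\<close>

theorem proposition7p3:
  fixes lam :: real and n :: nat
    and P :: "nat \<Rightarrow> real \<Rightarrow> real poly"
    and gam :: "nat \<Rightarrow> real \<Rightarrow> real"
    and x :: "nat \<Rightarrow> real \<Rightarrow> real"
  assumes "lam > -1/2" and "lam \<noteq> 1/2" and "n \<ge> 1"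
    and "\<And>z. z > 0 \<Longrightarrow> monic_orthogonal lam z (\<lambda>m. P m z)"
    and "\<And>z. z > 0 \<Longrightarrow> has_recurrence (\<lambda>m. P m z) (\<lambda>m. gam m z)"
    and "\<And>z. z > 0 \<Longrightarrow> zeros_in_order n (P n z) (\<lambda>k. x k z)"
  shows "\<forall>z > 0. \<forall>k \<in> {1..n}.
     beta_sq lam n z (\<lambda>m. gam m z) - (x k z)\<^sup>2 \<noteq> 0 \<and>
     ((\<lambda>s. x k s) has_real_derivative
        - (x k z / (2 * z)) *
          ((1 - (x k z)\<^sup>2) / (beta_sq lam n z (\<lambda>m. gam m z) - (x k z)\<^sup>2))) (at z)"
proof (intro allI impI ballI)
  fix z :: real and k :: nat
  assume z: "z > 0" and k: "k \<in> {1..n}"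
  obtain N where n: "n = Suc N"
    using assms(3) by (cases n) auto
  define t \<gamma> b where "t = x k z" and "\<gamma> = gam n z" and "b = beta_sq lam n z (\<lambda>m. gam m z) - t\<^sup>2"
  define Q P' where "Q = poly (P N z) t" and "P' = poly (pderiv (P n z)) t"
  note orth = assms(4)[OF z] and rec = assms(5)[OF z]
  interpret pearson_functional "weighted_integral lam z" lam z "\<lambda>m. P m z" "\<lambda>m. gam m z"
    by (rule pearson_functional_weighted_integral[OF assms(1) z orth rec])
  have root: "poly (P n z) t = 0"
    using assms(6)[OF z] k by (auto simp: zeros_in_order_def t_def)
  have "has_coeff_derivative (P n) (smult \<gamma> ([:0, 1:] * P N z - P n z)) z"
    unfolding n \<gamma>_def by (rule orthogonal_coeff_derivative[OF assms(1) z assms(4,5)])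
  moreover have "degree (P n s) = n" "lead_coeff (P n s) = 1" if "s > 0" for s
    using assms(4)[OF that] unfolding monic_orthogonal_def by blast+
  ultimately have P': "P' \<noteq> 0" and "((\<lambda>s. x k s) has_real_derivative
      - poly (smult \<gamma> ([:0, 1:] * P N z - P n z)) t / P') (at z)"
    unfolding P'_def t_def using zeros_have_derivative[where q = "P n" and x = x, OF z _ _ _ assms(6) k]
    by blast+
  then have der: "((\<lambda>s. x k s) has_real_derivative - (\<gamma> * t * Q) / P') (at z)"
    by (simp add: root Q_def mult.assoc)
  have "poly ([:1, 0, -1:] * pderiv (P n z)
      + smult (real n - 2 * z * \<gamma>) ([:0, 1:] * P n z)) t
      = poly (smult (2 * z * \<gamma>) ([:beta_sq lam n z (\<lambda>m. gam m z), 0, -1:] * P N z)) t"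
    unfolding n \<gamma>_def using structure_relation[of N] z by simp
  then have rel: "(1 - t\<^sup>2) * P' = 2 * z * \<gamma> * b * Q"
    by (simp add: root P'_def Q_def b_def power2_eq_square algebra_simps)
  have "t\<^sup>2 \<noteq> 1"
    using orthogonal_nonzero_at_endpoint[OF assms(1) z orth rec] root n by blast
  then have "2 * z * \<gamma> * b * Q \<noteq> 0"
    using P' rel by auto
  then have b: "b \<noteq> 0"
    by auto
  \<comment> \<open>Eliminating \<gamma> \<open>Q\<close> puts \<open>P'\<close> into the numerator,
    where it cancels against the denominator of the derivative.\<close>
  have "\<gamma> * Q = (1 - t\<^sup>2) * P' / (2 * z * b)"
    using rel z b by (simp add: field_simps)
  then have "- (\<gamma> * t * Q) / P' = - (t * ((1 - t\<^sup>2) * P' / (2 * z * b))) / P'"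
    by (metis mult.assoc mult.commute)
  also have "\<dots> = - (t / (2 * z)) * ((1 - t\<^sup>2) / b)"
    using P' z b by simp
  finally show "beta_sq lam n z (\<lambda>m. gam m z) - (x k z)\<^sup>2 \<noteq> 0 \<and>
     ((\<lambda>s. x k s) has_real_derivative
        - (x k z / (2 * z)) *
          ((1 - (x k z)\<^sup>2) / (beta_sq lam n z (\<lambda>m. gam m z) - (x k z)\<^sup>2))) (at z)"
    using der b unfolding t_def b_def by simp
qed

end
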